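(* For every integer $D\ge2$ there are arbitrarily large finite sets $P\subset\mathbb{R}^2$ (that is, for every $M$ there is such a $P$ with $|P|\ge M$), occupying exactly $D$ rays, with $$\max_{p\in P}\bigl|\{p\cdot q:q\in P\}\bigr|\ \le\ \frac{e\,|P|}{D},$$ where $e$ is the base of the natural logarithm. In particular, for every $\varepsilon>0$ there are arbitrarily large finite sets $P\subset\mathbb{R}^2$ with $$\max_{p\in P}\bigl|\{p\cdot q:q\in P\}\bigr|\le\varepsilon|P|.$$
   Context: $p\cdot q$ is the standard inner product on $\mathbb{R}^2$. A ray is an open half-line emanating from the origin; $P$ occupies a ray if the ray contains at least one point of $P$, and "occupying $D$ rays" means that the points of $P$ lie on exactly $D$ distinct rays. *)

theory Defs
  imports "HOL-Analysis.Analysis"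
begin

definition ray :: "(real ^ 2) set \<Rightarrow> bool" where
  "ray R \<longleftrightarrow> (\<exists>v. v \<noteq> 0 \<and> R = {t *\<^sub>R v | t. t > 0})"

definition occupied_rays :: "(real ^ 2) set \<Rightarrow> (real ^ 2) set set" where
  "occupied_rays P = {R. ray R \<and> R \<inter> P \<noteq> {}}"

(* Rays are open, so no ray contains the origin; requiring every point of P to
   lie on an occupied ray therefore excludes the origin from P.  The finiteness
   conjunct keeps card from being vacuous for D = 0. *)
definition occupies_exactly :: "(real ^ 2) set \<Rightarrow> nat \<Rightarrow> bool" where
  "occupies_exactly P D \<longleftrightarrow>
     P \<subseteq> \<Union> (occupied_rays P) \<and> finite (occupied_rays P) \<and> card (occupied_rays P) = D"

(* Meaningful only for finite nonempty P, where Max is the true maximum. *)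
definition max_dot_products :: "(real ^ 2) set \<Rightarrow> nat" where
  "max_dot_products P = Max ((\<lambda>p. card {p \<bullet> q | q. q \<in> P}) ` P)"

end

theory Submission
  imports Defs "HOL-Real_Asymp.Real_Asymp"
begin

text \<open>
  Put the same set of scalars \<open>A\<close> on each of the rays spanned by \<open>(1, i)\<close>, \<open>i < D\<close>.
  The inner products seen from \<open>a (1, i)\<close> lie in the union over \<open>j\<close> of \<open>a (1 + i j) A\<close>.
  Taking for \<open>A = A\<^sub>N\<close> the products of integers up to \<open>D\<^sup>2\<close> with all exponents at most \<open>N\<close>, this
  union is contained in \<open>a A\<^sub>N\<^sub>+\<^sub>1\<close>.  As the size of \<open>A\<^sub>N\<close> is polynomial in \<open>N\<close>,
  it cannot grow by a factor above \<open>e\<close> at every step.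
\<close>

section \<open>Growth of polynomially bounded sequences\<close>

text \<open>If every ratio from \<open>M\<close> on exceeded \<open>c\<close>, then
  \<open>f (M + k)\<close> would be at least \<open>c ^ k\<close>, starting from
  \<open>f M \<ge> 1\<close>. For large \<open>k\<close> this exceeds the polynomial bound of fixed
  degree \<open>B\<close>.\<close>

lemma polynomial_growth_ratio:
  fixes f :: "nat \<Rightarrow> nat"
  assumes pos: "\<And>n. f n > 0" and bound: "\<And>n. f n \<le> (n + 1) ^ B" and c: "c > (1::real)"
  shows "\<exists>n\<ge>M. real (f (Suc n)) \<le> c * real (f n)"
proof (rule ccontr)
  assume "\<not> ?thesis"
  then have step: "c * real (f n) < real (f (Suc n))" if "n \<ge> M" for n
    using that by force
  have lower: "c ^ k \<le> real (f (M + k))" for k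
  proof (induction k)
    case 0
    then show ?case using pos[of M] by simp
  next
    case (Suc k)
    have "c ^ Suc k \<le> c * real (f (M + k))"
      using Suc c by simp
    also have "\<dots> \<le> real (f (M + Suc k))"
      using step[of "M + k"] by simp
    finally show ?case .
  qed
  have "\<forall>\<^sub>F k in sequentially. real ((M + k + 1) ^ B) < c ^ k"
    unfolding of_nat_power of_nat_add using c by real_asymp
  then obtain k where "real ((M + k + 1) ^ B) < c ^ k"
    by (auto simp: eventually_sequentially)
  moreover have "real (f (M + k)) \<le> real ((M + k + 1) ^ B)"
    using bound[of "M + k"] by (simp only: of_nat_le_iff)
  ultimately show False
    using lower[of k] by linarith
qed

section \<open>Monomials with bounded exponents\<close>

text \<open>Exponent vectors are extensional on \<open>S\<close>, so for finite \<open>S\<close>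
  there are exactly \<open>(N + 1) ^ card S\<close> of them. Different vectors may give the same
  number; only the values are collected.\<close>

definition bounded_monomials :: "real set \<Rightarrow> nat \<Rightarrow> real set" where
  "bounded_monomials S N = (\<lambda>k. \<Prod>s\<in>S. s ^ k s) ` (S \<rightarrow>\<^sub>E {..N})"

lemma finite_bounded_monomials: "finite S \<Longrightarrow> finite (bounded_monomials S N)"
  by (simp add: bounded_monomials_def finite_PiE)

lemma card_bounded_monomials_le:
  assumes "finite S"
  shows "card (bounded_monomials S N) \<le> (N + 1) ^ card S"
proof -
  have "card (bounded_monomials S N) \<le> card (S \<rightarrow>\<^sub>E {..N})"
    unfolding bounded_monomials_def using assms by (intro card_image_le finite_PiE) auto
  then show ?thesis
    using assms by (simp add: card_PiE)
qed

lemma bounded_monomials_pos: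
  assumes "\<And>s. s \<in> S \<Longrightarrow> s > 0" and "a \<in> bounded_monomials S N"
  shows "a > 0"
  using assms by (auto simp: bounded_monomials_def intro!: prod_pos)

text \<open>Multiplying by \<open>s\<close> raises a single exponent by one. Hence all dilates of
  level \<open>N\<close> by elements of \<open>S\<close> fit together into level
  \<open>N + 1\<close>.\<close>

lemma mult_mem_bounded_monomials:
  assumes "finite S" "s \<in> S" "a \<in> bounded_monomials S N"
  shows "s * a \<in> bounded_monomials S (Suc N)"
proof -
  obtain k where k: "k \<in> S \<rightarrow>\<^sub>E {..N}" and a: "a = (\<Prod>t\<in>S. t ^ k t)"
    using assms(3) by (auto simp: bounded_monomials_def)
  let ?k = "k(s := Suc (k s))"
  have "?k \<in> S \<rightarrow>\<^sub>E {..Suc N}"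
    using k assms(2) by (auto simp: PiE_iff extensional_def le_SucI)
  moreover have "(\<Prod>t\<in>S. t ^ ?k t) = s * a"
  proof -
    have "(\<Prod>t\<in>S. t ^ ?k t) = s ^ Suc (k s) * (\<Prod>t\<in>S - {s}. t ^ k t)"
      using assms by (simp add: prod.remove[of S s])
    also have "\<dots> = s * a"
      unfolding a using assms by (simp add: prod.remove[of S s])
    finally show ?thesis .
  qed
  ultimately show ?thesis
    unfolding bounded_monomials_def by (intro rev_image_eqI[where x = ?k]) simp_all
qed

lemma power_mem_bounded_monomials:
  assumes "finite S" "s \<in> S" "n \<le> N"
  shows "s ^ n \<in> bounded_monomials S N"
proof -
  let ?k = "\<lambda>t\<in>S. if t = s then n else 0"
  have "(\<Prod>t\<in>S. t ^ ?k t) = (\<Prod>t\<in>S. if t = s then s ^ n else 1)"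
    by (rule prod.cong) auto
  also have "\<dots> = s ^ n"
    using assms by simp
  finally have "(\<Prod>t\<in>S. t ^ ?k t) = s ^ n" .
  moreover have "?k \<in> S \<rightarrow>\<^sub>E {..N}"
    using assms by auto
  ultimately show ?thesis
    unfolding bounded_monomials_def by (intro rev_image_eqI[where x = ?k]) simp_all
qed

text \<open>The powers \<open>s ^ 0\<close> to \<open>s ^ N\<close> are distinct because
  \<open>s > 1\<close>. This makes the point sets arbitrarily large.\<close>

lemma card_bounded_monomials_ge:
  assumes "finite S" "s \<in> S" "s > 1"
  shows "N < card (bounded_monomials S N)"
proof -
  have "inj_on (\<lambda>n. s ^ n) {..N}"
    using assms(3) by (auto simp: inj_on_def)
  then have "card ((\<lambda>n. s ^ n) ` {..N}) = Suc N"
    by (simp add: card_image)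
  moreover have "card ((\<lambda>n. s ^ n) ` {..N}) \<le> card (bounded_monomials S N)"
    using assms by (intro card_mono finite_bounded_monomials)
      (auto intro: power_mem_bounded_monomials)
  ultimately show ?thesis by simp
qed

section \<open>Directions and their rays\<close>

text \<open>With first coordinate 1, distinct indices give distinct rays, and all mutual inner
  products are positive integers; unit vectors would bring in square roots.\<close>

definition direction :: "nat \<Rightarrow> real ^ 2" where
  "direction i = vector [1, real i]"

lemma direction_nth [simp]: "direction i $ 1 = 1" "direction i $ 2 = real i"
  by (simp_all add: direction_def)

lemma direction_inner: "direction i \<bullet> direction j = real (1 + i * j)"
  by (simp add: inner_vec_def sum_2)

lemma direction_nonzero: "direction i \<noteq> 0"
  by (metis direction_nth(1) zero_index zero_neq_one)

text \<open>The first coordinate recovers the scalar; cancelling it in the second recovers the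
  index. At scalar 0 all indices would collapse to the origin.\<close>

lemma scaleR_direction_eq_iff:
  assumes "a \<noteq> 0"
  shows "a *\<^sub>R direction i = b *\<^sub>R direction j \<longleftrightarrow> a = b \<and> i = j"
  using assms by (auto simp: vec_eq_iff forall_2)

definition ray_of :: "nat \<Rightarrow> (real ^ 2) set" where
  "ray_of i = {t *\<^sub>R direction i | t. t > 0}"

lemma inj_ray_of: "inj ray_of"
proof (rule injI)
  fix i j assume eq: "ray_of i = ray_of j"
  have "1 *\<^sub>R direction i \<in> ray_of i"
    unfolding ray_of_def using zero_less_one by blast
  then obtain t where "1 *\<^sub>R direction i = t *\<^sub>R direction j"
    unfolding eq by (auto simp: ray_of_def)
  then show "i = j"
    using scaleR_direction_eq_iff[of 1] by simp
qed

section \<open>Point sets with the same scalars on every ray\<close>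

definition grid :: "nat \<Rightarrow> real set \<Rightarrow> (real ^ 2) set" where
  "grid D A = (\<lambda>(i, a). a *\<^sub>R direction i) ` ({..<D} \<times> A)"

lemma card_grid:
  assumes "\<And>a. a \<in> A \<Longrightarrow> a > 0"
  shows "card (grid D A) = D * card A"
proof -
  have "inj_on (\<lambda>(i, a). a *\<^sub>R direction i) ({..<D} \<times> A)"
    using assms by (force simp: inj_on_def scaleR_direction_eq_iff)
  then show ?thesis
    by (simp add: grid_def card_image card_cartesian_product)
qed

text \<open>The generator \<open>v\<close> of a ray is unique only up to a positive factor. One
  common point makes \<open>v\<close> a positive multiple of \<open>direction i\<close>, and
  rescaling the parameter identifies the two rays.\<close>

lemma ray_eq_ray_of:
  assumes "ray R" "a *\<^sub>R direction i \<in> R" "a > 0"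
  shows "R = ray_of i"
proof -
  obtain v where R: "R = {t *\<^sub>R v | t. t > 0}"
    using assms(1) by (auto simp: ray_def)
  then obtain t where t: "t > 0" "a *\<^sub>R direction i = t *\<^sub>R v"
    using assms(2) by auto
  have v: "v = (a / t) *\<^sub>R direction i"
    using arg_cong[OF t(2), of "\<lambda>x. (1 / t) *\<^sub>R x"] t(1) by simp
  show ?thesis
  proof (intro equalityI subsetI)
    fix x assume "x \<in> R"
    then obtain u where "u > 0" "x = u *\<^sub>R v" using R by auto
    then have "u * (a / t) > 0" "x = (u * (a / t)) *\<^sub>R direction i"
      using v t assms(3) by auto
    then show "x \<in> ray_of i" unfolding ray_of_def by blast
  next
    fix x assume "x \<in> ray_of i"
    then obtain u where u: "u > 0" "x = u *\<^sub>R direction i" by (auto simp: ray_of_def)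
    then have "u * (t / a) > 0" "x = (u * (t / a)) *\<^sub>R v"
      using v t assms(3) by auto
    then show "x \<in> R" unfolding R by blast
  qed
qed

text \<open>A ray meeting the grid is determined by the point where it does so; conversely, any one
  element of \<open>A\<close> marks a point on each \<open>ray_of i\<close>.\<close>

lemma occupied_rays_grid:
  assumes "\<And>a. a \<in> A \<Longrightarrow> a > 0" "A \<noteq> {}"
  shows "occupied_rays (grid D A) = ray_of ` {..<D}"
proof (intro equalityI subsetI)
  fix R assume "R \<in> occupied_rays (grid D A)"
  then obtain i a where "ray R" "i < D" "a \<in> A" "a *\<^sub>R direction i \<in> R"
    by (auto simp: occupied_rays_def grid_def)
  then show "R \<in> ray_of ` {..<D}"
    using ray_eq_ray_of assms by blast
next
  fix R assume "R \<in> ray_of ` {..<D}"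
  then obtain i where i: "i < D" "R = ray_of i" by auto
  obtain a where a: "a \<in> A" using assms(2) by auto
  have "a *\<^sub>R direction i \<in> R \<inter> grid D A"
    using i a assms(1)[OF a] by (auto simp: ray_of_def grid_def)
  moreover have "ray R"
    using i direction_nonzero[of i] by (auto simp: ray_def ray_of_def)
  ultimately show "R \<in> occupied_rays (grid D A)"
    by (auto simp: occupied_rays_def)
qed

lemma occupies_exactly_grid:
  assumes "\<And>a. a \<in> A \<Longrightarrow> a > 0" "A \<noteq> {}"
  shows "occupies_exactly (grid D A) D"
proof -
  have "card (ray_of ` {..<D}) = D"
    using inj_ray_of by (simp add: card_image inj_on_subset)
  moreover have "grid D A \<subseteq> \<Union> (ray_of ` {..<D})"
    using assms(1) by (auto simp: grid_def ray_of_def)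
  ultimately show ?thesis
    using occupied_rays_grid[OF assms, of D] by (simp add: occupies_exactly_def)
qed

text \<open>Seen from \<open>a *\<^sub>R direction i\<close>, every inner product is
  \<open>a\<close> times an element of \<open>B\<close>. The set \<open>B\<close> serves all points
  at once, and dilation by \<open>a\<close> cannot enlarge it.\<close>

lemma max_dot_products_grid_le:
  assumes "finite A" "A \<noteq> {}" "D > 0" "finite B"
    and AB: "\<And>i j a. i < D \<Longrightarrow> j < D \<Longrightarrow> a \<in> A \<Longrightarrow> real (1 + i * j) * a \<in> B"
  shows "max_dot_products (grid D A) \<le> card B"
proof -
  have "card {p \<bullet> q | q. q \<in> grid D A} \<le> card B" if p: "p \<in> grid D A" for p
  proof -
    obtain i a where ia: "i < D" "p = a *\<^sub>R direction i"
      using p by (auto simp: grid_def)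
    have "{p \<bullet> q | q. q \<in> grid D A} \<subseteq> (\<lambda>x. a * x) ` B"
    proof
      fix x assume "x \<in> {p \<bullet> q | q. q \<in> grid D A}"
      then obtain j b where jb: "j < D" "b \<in> A" "x = p \<bullet> (b *\<^sub>R direction j)"
        by (auto simp: grid_def)
      then have "x = a * (real (1 + i * j) * b)"
        by (simp add: ia direction_inner del: of_nat_add of_nat_mult)
      then show "x \<in> (\<lambda>x. a * x) ` B"
        using AB ia jb by blast
    qed
    then have "card {p \<bullet> q | q. q \<in> grid D A} \<le> card ((\<lambda>x. a * x) ` B)"
      using \<open>finite B\<close> by (intro card_mono) auto
    also have "\<dots> \<le> card B"
      using \<open>finite B\<close> by (rule card_image_le)
    finally show ?thesis .
  qed
  moreover have "finite (grid D A)" "grid D A \<noteq> {}"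
    using assms(1-3) by (auto simp: grid_def)
  ultimately show ?thesis
    unfolding max_dot_products_def by (subst Max_le_iff) auto
qed

section \<open>Choice of the scalars and conclusion\<close>

lemma exists_few_dot_products:
  fixes D M :: nat
  assumes D: "D \<ge> 2"
  shows "\<exists>P::(real ^ 2) set. finite P \<and> P \<noteq> {} \<and> card P \<ge> M \<and> occupies_exactly P D \<and>
           real (max_dot_products P) \<le> exp 1 * real (card P) / real D"
proof -
  \<comment> \<open>For \<open>i, j < D\<close> the coefficient \<open>1 + i * j\<close> is at most
    \<open>D\<^sup>2\<close>. As \<open>S\<close> depends on \<open>D\<close> alone, the degree
    \<open>card S\<close> of the polynomial bound stays fixed while \<open>N\<close> varies.\<close>
  define S where "S = real ` {1..D\<^sup>2}"
  have "2 \<le> D\<^sup>2"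
    using D self_le_power[of D 2] by simp
  \<comment> \<open>An element above 1, whose powers force the levels to grow.\<close>
  then have two: "2 \<in> S"
    unfolding S_def by (intro image_eqI[of _ _ 2]) auto
  have fin: "finite S" and pos: "\<And>s. s \<in> S \<Longrightarrow> s > 0"
    by (auto simp: S_def)
  have coeff: "real (1 + i * j) \<in> S" if "i < D" "j < D" for i j
  proof -
    have "i * j < D * D"
      using that by (intro mult_strict_mono) auto
    then show ?thesis
      unfolding S_def by (intro imageI) (simp add: power2_eq_square)
  qed
  let ?A = "bounded_monomials S"
  have ge: "N < card (?A N)" for N
    using card_bounded_monomials_ge[OF fin two] by simp
  \<comment> \<open>The growth lemma with ratio \<open>exp 1 > 1\<close>. Starting the search at
    \<open>M\<close> also secures \<open>card P \<ge> M\<close>, since level \<open>N\<close> has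
    more than \<open>N\<close> elements.\<close>
  obtain N where "N \<ge> M" and N: "real (card (?A (Suc N))) \<le> exp 1 * real (card (?A N))"
    using polynomial_growth_ratio[of "\<lambda>N. card (?A N)" "card S" "exp 1" M]
      le_less_trans[OF le0 ge] card_bounded_monomials_le[OF fin] by auto
  define P where "P = grid D (?A N)"
  have Apos: "\<And>a. a \<in> ?A N \<Longrightarrow> a > 0"
    using bounded_monomials_pos pos by blast
  have finA: "finite (?A N)" and ne: "?A N \<noteq> {}"
    using ge[of N] finite_bounded_monomials[OF fin] by auto
  have cardP: "card P = D * card (?A N)"
    unfolding P_def using Apos by (rule card_grid)
  have "max_dot_products P \<le> card (?A (Suc N))"
    unfolding P_def using finA ne D
    by (intro max_dot_products_grid_le finite_bounded_monomials fin
        mult_mem_bounded_monomials coeff) auto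
  then have "real (max_dot_products P) \<le> exp 1 * real (card (?A N))"
    using N by linarith
  also have "\<dots> = exp 1 * real (card P) / real D"
    using D by (simp add: cardP)
  finally have "real (max_dot_products P) \<le> exp 1 * real (card P) / real D" .
  moreover have "occupies_exactly P D"
    unfolding P_def using Apos ne by (rule occupies_exactly_grid)
  moreover have "finite P" "P \<noteq> {}"
    using finA ne D by (auto simp: P_def grid_def lessThan_empty_iff)
  moreover have "card P \<ge> M"
  proof -
    have "M \<le> 1 * card (?A N)" using ge[of N] \<open>N \<ge> M\<close> by simp
    also have "\<dots> \<le> D * card (?A N)" using D by (intro mult_le_mono1) simp
    finally show ?thesis by (simp add: cardP)
  qed
  ultimately show ?thesis by blast
qed

theorem proposition6p1:
  shows "(\<forall>D::nat. D \<ge> 2 \<longrightarrow>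
            (\<forall>M::nat. \<exists>P::(real ^ 2) set. finite P \<and> P \<noteq> {} \<and> card P \<ge> M \<and> occupies_exactly P D \<and>
               real (max_dot_products P) \<le> exp 1 * real (card P) / real D))
       \<and> (\<forall>\<epsilon>::real. \<epsilon> > 0 \<longrightarrow>
            (\<forall>M::nat. \<exists>P::(real ^ 2) set. finite P \<and> P \<noteq> {} \<and> card P \<ge> M \<and>
               real (max_dot_products P) \<le> \<epsilon> * real (card P)))"
proof (intro conjI allI impI)
  fix D M :: nat
  assume "D \<ge> 2"
  then show "\<exists>P::(real ^ 2) set. finite P \<and> P \<noteq> {} \<and> card P \<ge> M \<and> occupies_exactly P D \<and>
               real (max_dot_products P) \<le> exp 1 * real (card P) / real D"
    by (rule exists_few_dot_products)
next
  fix \<epsilon> :: real and M :: nat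
  assume eps: "\<epsilon> > 0"
  obtain n where n: "exp 1 / \<epsilon> < real n"
    using reals_Archimedean2 by blast
  \<comment> \<open>Taking \<open>D\<close> at least \<open>exp 1 / \<epsilon>\<close> turns the
    factor \<open>exp 1 / D\<close> into at most \<epsilon>; the maximum with 2 keeps
    \<open>D\<close> in the range of the first claim.\<close>
  define D where "D = max 2 n"
  have D: "D \<ge> 2" "exp 1 / \<epsilon> \<le> real D"
    using n by (auto simp: D_def)
  then have "exp 1 / real D \<le> \<epsilon>"
    using eps by (simp add: field_simps)
  then have "exp 1 * real k / real D \<le> \<epsilon> * real k" for k
    using mult_right_mono[of "exp 1 / real D" \<epsilon> "real k"] by simp
  then show "\<exists>P::(real ^ 2) set. finite P \<and> P \<noteq> {} \<and> card P \<ge> M \<and>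
               real (max_dot_products P) \<le> \<epsilon> * real (card P)"
    using exists_few_dot_products[OF D(1), of M] by (meson order_trans)
qed

end
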